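(* Let $\rho$ be any density matrix on $\mathbb{C}^d$, let $\{|a_i\rangle\}_{i=1}^d$ and $\{|b_j\rangle\}_{j=1}^d$ be two orthonormal bases of $\mathbb{C}^d$, let $U_{ij}=\langle a_i|b_j\rangle$, and let $p_i=\langle a_i|\rho|a_i\rangle$, $q_j=\langle b_j|\rho|b_j\rangle$. Let $c=(c_1,c_2,\dots,c_{d^2})$ be the $d^2$ numbers $|U_{ij}|^2$ arranged in decreasing order, and put $C=(1+\sqrt{c_1})/2$. Let $S(\rho)=-\mathrm{Tr}\,\rho\ln\rho$. (i) If $Q=(Q_1,\dots,Q_{d^2})$ is a probability vector with $Q_1\ge Q_2\ge\dots\ge Q_{d^2}$ such that $p\otimes q\prec Q$, then $$H(p)+H(q)\ge -\ln(Q\cdot c)+S(\rho),$$ where $Q\cdot c=\sum_{n}Q_nc_n$. (ii) $$H(p)+H(q)\ge -\ln\left[c_1C^2+c_2(1-C^2)\right]+S(\rho).$$ (iii) If $Q$ is as in (i), then for each pair $(k,l)\in\{1,\dots,d\}^2$ let $h_{kl}\in\mathbb{R}^{d^2}$ be the vector of the $d^2$ numbers $|U_{kj}|^2|U_{il}|^2$, $(i,j)\in\{1,\dots,d\}^2$, arranged in decreasing order, and let $g=(g_1,\dots,g_{d^2})$ be the $d^2$ numbers $-\ln(Q\cdot h_{kl})$, $(k,l)\in\{1,\dots,d\}^2$, arranged in increasing order. Then $$H(p)+H(q)\ge \frac12\sum_{n=1}^{d^2}Q_n g_n+S(\rho).$$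
   Context: $H(p)=-\sum_i p_i\ln p_i$ is the Shannon entropy (natural logarithm). $p\otimes q$ denotes the $d^2$-dimensional probability vector with entries $p_iq_j$. For probability vectors $x,y$ of the same length, $x\prec y$ (majorization) means $\sum_{k=1}^n x^{\downarrow}_k\le\sum_{k=1}^n y^{\downarrow}_k$ for all $n$, with equality for $n$ equal to the full length, where $x^{\downarrow}$ is $x$ sorted in decreasing order. *)

theory Defs
  imports "HOL-Analysis.Analysis" "HOL-Library.Multiset"
begin

definition cinner :: "complex ^ 'n \<Rightarrow> complex ^ 'n \<Rightarrow> complex" where
  "cinner x y = (\<Sum>i\<in>UNIV. cnj (x $ i) * y $ i)"

definition orthonormal_basis :: "('n::finite \<Rightarrow> complex ^ 'n) \<Rightarrow> bool" where
  "orthonormal_basis e \<longleftrightarrow> (\<forall>i j. cinner (e i) (e j) = (if i = j then 1 else 0))"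

definition density_matrix :: "complex ^ 'n ^ 'n \<Rightarrow> bool" where
  "density_matrix \<rho> \<longleftrightarrow>
     (\<forall>i j. \<rho> $ i $ j = cnj (\<rho> $ j $ i)) \<and>
     (\<forall>x. Re (cinner x (\<rho> *v x)) \<ge> 0) \<and>
     (\<Sum>i\<in>UNIV. \<rho> $ i $ i) = 1"

definition outer :: "complex ^ 'n \<Rightarrow> complex ^ 'n \<Rightarrow> complex ^ 'n ^ 'n" where
  "outer x y = (\<chi> i j. x $ i * cnj (y $ j))"

(* von Neumann entropy S(rho) = - Tr rho ln rho, computed via a spectral decomposition
   rho = sum_k lambda_k |e_k><e_k| (with 0 ln 0 = 0, as ln 0 = 0 in Isabelle) *)
definition vn_entropy :: "complex ^ 'n ^ 'n \<Rightarrow> real" where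
  "vn_entropy \<rho> = (SOME s. \<exists>(e :: 'n \<Rightarrow> complex ^ 'n) (lam :: 'n \<Rightarrow> real).
      orthonormal_basis e \<and> \<rho> = (\<Sum>k\<in>UNIV. lam k *\<^sub>R outer (e k) (e k)) \<and>
      s = - (\<Sum>k\<in>UNIV. lam k * ln (lam k)))"

definition shannon :: "('a::finite \<Rightarrow> real) \<Rightarrow> real" where
  "shannon p = - (\<Sum>i\<in>UNIV. p i * ln (p i))"

definition decr_list :: "('a::finite \<Rightarrow> real) \<Rightarrow> real list" where
  "decr_list f = rev (sorted_list_of_multiset (image_mset f (mset_set UNIV)))"

definition incr_list :: "('a::finite \<Rightarrow> real) \<Rightarrow> real list" where
  "incr_list f = sorted_list_of_multiset (image_mset f (mset_set UNIV))"

definition decr :: "real list \<Rightarrow> real list" where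
  "decr xs = rev (sort xs)"

definition majorized :: "real list \<Rightarrow> real list \<Rightarrow> bool" where
  "majorized x y \<longleftrightarrow> length x = length y \<and>
     (\<forall>n \<le> length x. sum_list (take n (decr x)) \<le> sum_list (take n (decr y))) \<and>
     sum_list x = sum_list y"

definition dotl :: "real list \<Rightarrow> real list \<Rightarrow> real" where
  "dotl x y = sum_list (map (\<lambda>(u, v). u * v) (zip x y))"

end

theory Submission
  imports Defs
begin

text \<open>
  Write \<open>\<sigma> = \<Sum>\<^sub>i p\<^sub>i |a\<^sub>i\<rangle>\<langle>a\<^sub>i|\<close> and \<open>r\<^sub>j = \<langle>b\<^sub>j|\<sigma>|b\<^sub>j\<rangle> = \<Sum>\<^sub>i p\<^sub>i |U\<^sub>i\<^sub>j|\<^sup>2\<close>. Then \<open>H(p) - S(\<rho>)\<close> is the relative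
  entropy \<open>D(\<rho>\<parallel>\<sigma>)\<close>, and measuring in the basis \<open>b\<close> can only decrease it:
  \<open>H(p) + H(q) - S(\<rho>) \<ge> - \<Sum>\<^sub>j q\<^sub>j ln r\<^sub>j\<close>. This monotonicity is proved in scalar form. With
  \<open>\<rho> = \<Sum>\<^sub>k \<lambda>\<^sub>k |e\<^sub>k\<rangle>\<langle>e\<^sub>k|\<close> and \<open>w\<^sub>k\<^sub>i = |\<langle>e\<^sub>k|a\<^sub>i\<rangle>|\<^sup>2\<close>, completing a square gives, for every \<open>s \<ge> 0\<close>,
  \<open>\<Sum>\<^sub>j q\<^sub>j\<^sup>2 / (r\<^sub>j + s q\<^sub>j) \<le> \<Sum>\<^sub>k\<^sub>i w\<^sub>k\<^sub>i \<lambda>\<^sub>k\<^sup>2 / (p\<^sub>i + s \<lambda>\<^sub>k)\<close>, and integrating over \<open>s\<close> turns both sides into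
  relative entropies.

  By concavity of the logarithm \<open>H(p) + H(q) - S(\<rho>) \<ge> - ln (\<Sum>\<^sub>i\<^sub>j p\<^sub>i q\<^sub>j |U\<^sub>i\<^sub>j|\<^sup>2)\<close>. Summation by parts bounds
  the sum by \<open>Q \<cdot> c\<close> whenever \<open>p \<otimes> q \<prec> Q\<close>, which is (i). For (ii), the Landau-Pollak inequality
  \<open>p\<^sub>i + q\<^sub>j \<le> 1 + |U\<^sub>i\<^sub>j|\<close> bounds the weight \<open>p\<^sub>i q\<^sub>j\<close> of the largest overlap by \<open>C\<^sup>2\<close>. For (iii), one averages the
  bound with its counterpart in which \<open>a\<close> and \<open>b\<close> are exchanged before applying the majorization argument,
  once inside and once outside the logarithm.
\<close>

section \<open>The complex inner product and orthonormal bases\<close>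

lemma cinner_add_right: "cinner x (y + z) = cinner x y + cinner x z"
  by (simp add: cinner_def distrib_left sum.distrib)

lemma cinner_add_left: "cinner (x + y) z = cinner x z + cinner y z"
  by (simp add: cinner_def distrib_right sum.distrib)

lemma cinner_scaleR_right: "cinner x (r *\<^sub>R y) = of_real r * cinner x y"
  by (simp add: cinner_def scaleR_sum_right flip: scaleR_conv_of_real)

lemma cinner_scaleR_left: "cinner (r *\<^sub>R x) y = of_real r * cinner x y"
  by (simp add: cinner_def scaleR_sum_right flip: scaleR_conv_of_real)

lemma cinner_scale_right: "cinner x (z *s y) = z * cinner x y"
  by (simp add: cinner_def sum_distrib_left mult_ac)

lemma cinner_scale_left: "cinner (z *s x) y = cnj z * cinner x y"
  by (simp add: cinner_def sum_distrib_left mult_ac)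

lemma cinner_sum_right: "cinner x (\<Sum>k\<in>K. f k) = (\<Sum>k\<in>K. cinner x (f k))"
  by (induction K rule: infinite_finite_induct)
     (simp_all add: cinner_add_right, simp_all add: cinner_def)

lemma cinner_sum_left: "cinner (\<Sum>k\<in>K. f k) y = (\<Sum>k\<in>K. cinner (f k) y)"
  by (induction K rule: infinite_finite_induct)
     (simp_all add: cinner_add_left, simp_all add: cinner_def)

lemma cnj_cinner: "cnj (cinner x y) = cinner y x"
  by (simp add: cinner_def mult.commute)

lemma cmod_cinner_commute: "cmod (cinner x y) = cmod (cinner y x)"
  by (metis cnj_cinner complex_mod_cnj)

lemma inner_eq_Re_cinner: "x \<bullet> y = Re (cinner x y)"
  by (simp add: inner_vec_def cinner_def inner_complex_def)

lemma cinner_self: "cinner x x = of_real ((norm x)\<^sup>2)"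
proof -
  have "Im (cinner x x) = 0"
    by (metis cnj_cinner Reals_cnj_iff complex_is_Real_iff)
  moreover have "Re (cinner x x) = (norm x)\<^sup>2"
    by (simp flip: inner_eq_Re_cinner add: power2_norm_eq_inner)
  ultimately show ?thesis by (simp add: complex_eq_iff)
qed

lemma cinner_matrix_hermitian:
  fixes \<rho> :: "complex ^ 'n ^ 'n"
  assumes "\<And>i j. \<rho> $ i $ j = cnj (\<rho> $ j $ i)"
  shows "cinner x (\<rho> *v y) = cinner (\<rho> *v x) y"
proof -
  have "cinner x (\<rho> *v y) = (\<Sum>i\<in>UNIV. \<Sum>j\<in>UNIV. cnj (x $ i) * \<rho> $ i $ j * y $ j)"
    by (simp add: cinner_def matrix_vector_mult_def sum_distrib_left mult_ac)
  also have "\<dots> = (\<Sum>j\<in>UNIV. \<Sum>i\<in>UNIV. cnj (x $ i) * cnj (\<rho> $ j $ i) * y $ j)"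
    by (subst sum.swap) (simp flip: assms)
  also have "\<dots> = cinner (\<rho> *v x) y"
    by (simp add: cinner_def matrix_vector_mult_def sum_distrib_left sum_distrib_right mult_ac)
  finally show ?thesis .
qed

text \<open>Orthonormality says that the matrix with columns \<open>e k\<close> has its adjoint as a
  left inverse. For a square matrix this is also a right inverse, whose entries give the resolution
  of the identity.\<close>

lemma orthonormal_basis_complete:
  fixes e :: "'n::finite \<Rightarrow> complex ^ 'n"
  assumes "orthonormal_basis e"
  shows "(\<Sum>k\<in>UNIV. e k $ i * cnj (e k $ j)) = (if i = j then 1 else 0)"
proof -
  define E :: "complex ^ 'n ^ 'n" where "E = (\<chi> i k. e k $ i)"
  define E' :: "complex ^ 'n ^ 'n" where "E' = (\<chi> k i. cnj (e k $ i))"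
  have "E' ** E = mat 1"
    using assms
    by (simp add: E_def E'_def matrix_matrix_mult_def mat_def vec_eq_iff
        orthonormal_basis_def cinner_def)
  then have "E ** E' = mat 1"
    by (simp add: matrix_left_right_inverse)
  then have "(E ** E') $ i $ j = mat 1 $ i $ j" by simp
  then show ?thesis
    by (simp add: E_def E'_def matrix_matrix_mult_def mat_def)
qed

lemma cinner_parseval:
  fixes e :: "'n::finite \<Rightarrow> complex ^ 'n"
  assumes "orthonormal_basis e"
  shows "cinner x y = (\<Sum>k\<in>UNIV. cinner x (e k) * cinner (e k) y)"
proof -
  have "(\<Sum>k\<in>UNIV. cinner x (e k) * cinner (e k) y)
      = (\<Sum>k\<in>UNIV. \<Sum>i\<in>UNIV. \<Sum>j\<in>UNIV. cnj (x $ i) * y $ j * (e k $ i * cnj (e k $ j)))"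
    by (simp add: cinner_def sum_product) (simp add: mult_ac)
  also have "\<dots> = (\<Sum>i\<in>UNIV. \<Sum>k\<in>UNIV. \<Sum>j\<in>UNIV. cnj (x $ i) * y $ j * (e k $ i * cnj (e k $ j)))"
    by (rule sum.swap)
  also have "\<dots> = (\<Sum>i\<in>UNIV. \<Sum>j\<in>UNIV. \<Sum>k\<in>UNIV. cnj (x $ i) * y $ j * (e k $ i * cnj (e k $ j)))"
    by (intro sum.cong refl sum.swap)
  also have "\<dots> = (\<Sum>i\<in>UNIV. \<Sum>j\<in>UNIV. cnj (x $ i) * y $ j * (if i = j then 1 else 0))"
    by (simp only: orthonormal_basis_complete[OF assms] flip: sum_distrib_left)
  also have "\<dots> = cinner x y"
    by (simp add: cinner_def if_distrib cong: if_cong)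
  finally show ?thesis ..
qed

lemma sum_cmod_cinner_squared:
  fixes e :: "'n::finite \<Rightarrow> complex ^ 'n"
  assumes "orthonormal_basis e"
  shows "(\<Sum>k\<in>UNIV. (cmod (cinner x (e k)))\<^sup>2) = (norm x)\<^sup>2"
proof -
  have "of_real ((norm x)\<^sup>2) = (\<Sum>k\<in>UNIV. cinner x (e k) * cnj (cinner x (e k)))"
    by (simp only: cinner_parseval[OF assms, of x x] cnj_cinner flip: cinner_self)
  also have "\<dots> = of_real (\<Sum>k\<in>UNIV. (cmod (cinner x (e k)))\<^sup>2)"
    by (simp only: of_real_sum flip: complex_norm_square)
  finally show ?thesis by (simp only: of_real_eq_iff)
qed

lemma norm_orthonormal_basis: "orthonormal_basis e \<Longrightarrow> norm (e k) = 1"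
  by (simp add: norm_eq_sqrt_inner inner_eq_Re_cinner orthonormal_basis_def)

section \<open>Spectral decomposition of Hermitian matrices\<close>

text \<open>Dimensions are counted over the reals, where \<open>complex ^ 'n\<close> has dimension
  \<open>2 * CARD('n)\<close>. Complex orthogonality to \<open>e k\<close> is real orthogonality to
  both \<open>e k\<close> and \<open>\<i> *s e k\<close>, so at most \<open>2 * card S\<close> real
  conditions arise.\<close>

lemma nonzero_orthogonal_vector_exists:
  fixes e :: "'n::finite \<Rightarrow> complex ^ 'n"
  assumes "card S < CARD('n)"
  obtains x where "x \<noteq> 0" "\<And>k. k \<in> S \<Longrightarrow> cinner (e k) x = 0"
proof -
  let ?T = "e ` S \<union> (\<lambda>k. \<i> *s e k) ` S"
  have "card ?T \<le> card (e ` S) + card ((\<lambda>k. \<i> *s e k) ` S)" by (rule card_Un_le)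
  also have "\<dots> \<le> card S + card S" by (intro add_mono card_image_le) simp_all
  also have "\<dots> < DIM(complex ^ 'n)" using assms by simp
  finally have "dim ?T < DIM(complex ^ 'n)"
    using dim_le_card'[of ?T] by simp
  then obtain x where x: "x \<noteq> 0" "\<And>y. y \<in> span ?T \<Longrightarrow> orthogonal x y"
    using orthogonal_to_subspace_exists by blast
  have "cinner (e k) x = 0" if "k \<in> S" for k
  proof -
    have "orthogonal x (e k)" "orthogonal x (\<i> *s e k)"
      using that by (auto intro!: x(2) span_base)
    then have "Re (cinner (e k) x) = 0" "Re (cinner (\<i> *s e k) x) = 0"
      by (simp_all add: orthogonal_def inner_commute flip: inner_eq_Re_cinner)
    then show ?thesis by (simp add: cinner_scale_left complex_eq_iff)
  qed
  with x(1) show ?thesis using that by blast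
qed

text \<open>The first-order condition at an extremum: for small \<open>t\<close> the linear term
  dominates.\<close>

lemma linear_coefficient_zero:
  fixes m K :: real
  assumes "\<And>t. 0 \<le> 2 * t * m + t\<^sup>2 * K"
  shows "m = 0"
proof (rule ccontr)
  assume "m \<noteq> 0"
  \<comment> \<open>\<open>L\<close> is a positive upper bound of \<open>K\<close>, and
    \<open>t = - m / L\<close> minimises \<open>2 * t * m + t\<^sup>2 * L\<close>.\<close>
  define L where "L = \<bar>K\<bar> + 1"
  have L: "L > 0" "K \<le> L" by (auto simp: L_def)
  have "0 \<le> 2 * (- m / L) * m + (- m / L)\<^sup>2 * K" by (rule assms)
  also have "\<dots> \<le> 2 * (- m / L) * m + (- m / L)\<^sup>2 * L"
    using L by (intro add_left_mono mult_left_mono) auto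
  also have "\<dots> = - m\<^sup>2 / L" using L by (simp add: field_simps power2_eq_square)
  also have "\<dots> < 0" using L \<open>m \<noteq> 0\<close> by simp
  finally show False by simp
qed

text \<open>The eigenvector is a maximiser of the Rayleigh quotient on the unit sphere of \<open>W\<close>.\<close>

lemma self_adjoint_eigenvector_in_subspace:
  fixes f :: "'a::euclidean_space \<Rightarrow> 'a"
  assumes lin: "linear f" and adj: "\<And>x y. x \<bullet> f y = f x \<bullet> y"
    and W: "subspace W" and inv: "\<And>x. x \<in> W \<Longrightarrow> f x \<in> W"
    and x0: "x0 \<in> W" "x0 \<noteq> 0"
  obtains v \<mu> where "v \<in> W" "norm v = 1" "f v = \<mu> *\<^sub>R v"
proof -
  have cont: "continuous_on A f" for A
    using lin by (simp add: linear_continuous_on linear_conv_bounded_linear)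
  have "compact (sphere 0 1 \<inter> W)"
    by (intro compact_Int_closed closed_subspace W) simp
  moreover have "x0 /\<^sub>R norm x0 \<in> sphere 0 1 \<inter> W"
    using x0 W by (simp add: subspace_scale)
  moreover have "continuous_on (sphere 0 1 \<inter> W) (\<lambda>x. x \<bullet> f x)"
    by (intro continuous_intros cont)
  ultimately obtain v where v: "v \<in> sphere 0 1 \<inter> W"
    and max: "\<And>y. y \<in> sphere 0 1 \<inter> W \<Longrightarrow> y \<bullet> f y \<le> v \<bullet> f v"
    using continuous_attains_sup[of "sphere 0 1 \<inter> W" "\<lambda>x. x \<bullet> f x"] by blast
  define \<mu> where "\<mu> = v \<bullet> f v"
  have vv: "v \<bullet> v = 1" and vW: "v \<in> W"
    using v by (simp_all add: dot_square_norm)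
  \<comment> \<open>Homogeneity carries the maximality on the unit sphere over to all of
    \<open>W\<close>.\<close>
  have bound: "x \<bullet> f x \<le> \<mu> * (x \<bullet> x)" if "x \<in> W" for x
  proof (cases "x = 0")
    case True
    then show ?thesis by simp
  next
    case False
    have "(x /\<^sub>R norm x) \<bullet> f (x /\<^sub>R norm x) \<le> \<mu>"
      unfolding \<mu>_def using that False W by (intro max) (simp add: subspace_scale)
    then have "(x \<bullet> f x) / (norm x)\<^sup>2 \<le> \<mu>"
      using lin by (simp add: linear_scale power2_eq_square divide_simps)
    then show ?thesis using False
      by (simp add: pos_divide_le_eq power2_norm_eq_inner)
  qed
  \<comment> \<open>Along \<open>v + t *\<^sub>R w\<close> the function
    \<open>\<mu> * (x \<bullet> x) - x \<bullet> f x\<close> is nonnegative and vanishes at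
    \<open>t = 0\<close>, so its linear coefficient is zero.\<close>
  have orth: "(\<mu> *\<^sub>R v - f v) \<bullet> w = 0" if w: "w \<in> W" for w
  proof (rule linear_coefficient_zero)
    fix t :: real
    have "v + t *\<^sub>R w \<in> W" using W vW w by (simp add: subspace_add subspace_scale)
    from bound[OF this] have "(v + t *\<^sub>R w) \<bullet> f (v + t *\<^sub>R w) \<le> \<mu> * ((v + t *\<^sub>R w) \<bullet> (v + t *\<^sub>R w))" .
    moreover have "w \<bullet> f v = f v \<bullet> w" "v \<bullet> f w = f v \<bullet> w" "v \<bullet> f v = \<mu>"
      by (rule inner_commute, rule adj, simp add: \<mu>_def)
    moreover have "f (v + t *\<^sub>R w) = f v + t *\<^sub>R f w"
      using lin by (simp add: linear_add linear_scale)
    moreover have "w \<bullet> v = v \<bullet> w" by (rule inner_commute)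
    ultimately show "0 \<le> 2 * t * ((\<mu> *\<^sub>R v - f v) \<bullet> w) + t\<^sup>2 * (\<mu> * (w \<bullet> w) - w \<bullet> f w)"
      using vv
      by (simp add: inner_add_left inner_add_right inner_diff_left power2_eq_square algebra_simps)
  qed
  \<comment> \<open>By invariance the residual lies in \<open>W\<close>, hence is orthogonal to
    itself.\<close>
  have "\<mu> *\<^sub>R v - f v \<in> W" using W vW inv by (simp add: subspace_diff subspace_scale)
  from orth[OF this] have "f v = \<mu> *\<^sub>R v" by simp
  then show ?thesis using that v by auto
qed

text \<open>Induction on the index set: orthonormal eigenvectors indexed by \<open>S\<close> are
  extended by one taken from their orthogonal complement \<open>W\<close>, which is invariant
  because \<open>\<rho>\<close> is Hermitian.\<close>

lemma spectral_decomposition: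
  fixes \<rho> :: "complex ^ 'n ^ 'n"
  assumes herm: "\<And>i j. \<rho> $ i $ j = cnj (\<rho> $ j $ i)"
  obtains e :: "'n \<Rightarrow> complex ^ 'n" and lam :: "'n \<Rightarrow> real"
  where "orthonormal_basis e" "\<rho> = (\<Sum>k\<in>UNIV. lam k *\<^sub>R outer (e k) (e k))"
proof -
  have "\<exists>(e :: 'n \<Rightarrow> complex ^ 'n) lam :: 'n \<Rightarrow> real.
      (\<forall>i\<in>S. \<forall>j\<in>S. cinner (e i) (e j) = (if i = j then 1 else 0)) \<and>
      (\<forall>k\<in>S. \<rho> *v e k = lam k *\<^sub>R e k)" for S :: "'n set"
    using finite[of S]
  proof (induction S rule: finite_induct)
    case empty
    then show ?case by simp
  next
    case (insert m S)
    then obtain e :: "'n \<Rightarrow> complex ^ 'n" and lam :: "'n \<Rightarrow> real" where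
      on: "\<And>i j. i \<in> S \<Longrightarrow> j \<in> S \<Longrightarrow> cinner (e i) (e j) = (if i = j then 1 else 0)"
      and ev: "\<And>k. k \<in> S \<Longrightarrow> \<rho> *v e k = lam k *\<^sub>R e k"
      by blast
    define W where "W = {x. \<forall>k\<in>S. cinner (e k) x = 0}"
    have "subspace W"
      by (simp add: subspace_def W_def cinner_add_right cinner_scaleR_right)
         (simp add: cinner_def)
    moreover have "\<rho> *v x \<in> W" if "x \<in> W" for x
      using that by (simp add: W_def cinner_matrix_hermitian[OF herm] ev cinner_scaleR_left)
    moreover have "x \<bullet> (\<rho> *v y) = (\<rho> *v x) \<bullet> y" for x y
      by (simp add: inner_eq_Re_cinner cinner_matrix_hermitian[OF herm])
    moreover have "linear ((*v) \<rho>)"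
      by (rule linearI)
         (simp_all add: matrix_vector_right_distrib,
          simp add: matrix_vector_mult_def vec_eq_iff scaleR_sum_right)
    moreover obtain x0 where "x0 \<in> W" "x0 \<noteq> 0"
    proof -
      have "card S < CARD('n)"
        using insert.hyps by (metis UNIV_I finite psubset_card_mono psubsetI subset_UNIV)
      then show ?thesis
        by (rule nonzero_orthogonal_vector_exists[of S e]) (rule that, auto simp: W_def)
    qed
    ultimately obtain v \<mu> where v: "v \<in> W" "norm v = 1" "\<rho> *v v = \<mu> *\<^sub>R v"
      using self_adjoint_eigenvector_in_subspace[of "(*v) \<rho>" W x0] by blast
    have vv: "cinner v v = 1" using v(2) by (simp add: cinner_self)
    have ev0: "cinner (e k) v = 0" "cinner v (e k) = 0" if "k \<in> S" for k
      using v(1) that cnj_cinner[of "e k" v] by (auto simp: W_def)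
    show ?case
      by (rule exI[of _ "e(m := v)"], rule exI[of _ "lam(m := \<mu>)"])
         (use v(3) vv ev0 on ev \<open>m \<notin> S\<close> in auto)
  qed
  from this[of UNIV] obtain e :: "'n \<Rightarrow> complex ^ 'n" and lam :: "'n \<Rightarrow> real" where
    on: "orthonormal_basis e" and ev: "\<And>k. \<rho> *v e k = lam k *\<^sub>R e k"
    by (auto simp: orthonormal_basis_def)
  \<comment> \<open>Multiplying \<open>\<rho>\<close> by the resolution of the identity and using
    the eigenvalue equation gives the spectral sum.\<close>
  have "\<rho> $ i $ j = (\<Sum>k\<in>UNIV. lam k *\<^sub>R outer (e k) (e k)) $ i $ j" for i j
  proof -
    have "\<rho> $ i $ j = (\<Sum>m\<in>UNIV. \<rho> $ i $ m * (if m = j then 1 else 0))"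
      by (simp add: if_distrib cong: if_cong)
    also have "\<dots> = (\<Sum>m\<in>UNIV. \<Sum>k\<in>UNIV. \<rho> $ i $ m * (e k $ m * cnj (e k $ j)))"
      by (simp only: orthonormal_basis_complete[OF on, symmetric] sum_distrib_left)
    also have "\<dots> = (\<Sum>k\<in>UNIV. \<Sum>m\<in>UNIV. \<rho> $ i $ m * (e k $ m * cnj (e k $ j)))"
      by (rule sum.swap)
    also have "\<dots> = (\<Sum>k\<in>UNIV. (\<rho> *v e k) $ i * cnj (e k $ j))"
      by (simp add: matrix_vector_mult_def sum_distrib_right mult.assoc)
    also have "\<dots> = (\<Sum>k\<in>UNIV. lam k *\<^sub>R outer (e k) (e k)) $ i $ j"
      by (simp add: ev outer_def)
    finally show ?thesis .
  qed
  then have "\<rho> = (\<Sum>k\<in>UNIV. lam k *\<^sub>R outer (e k) (e k))"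
    unfolding vec_eq_iff by blast
  then show ?thesis using that on by blast
qed

lemma spectral_sum_mult_vec:
  fixes e :: "'n::finite \<Rightarrow> complex ^ 'n" and lam :: "'n \<Rightarrow> real"
  shows "(\<Sum>k\<in>UNIV. lam k *\<^sub>R outer (e k) (e k)) *v x = (\<Sum>k\<in>UNIV. lam k *\<^sub>R (cinner (e k) x *s e k))"
proof -
  have "((\<Sum>k\<in>UNIV. lam k *\<^sub>R outer (e k) (e k)) *v x) $ i
      = (\<Sum>j\<in>UNIV. \<Sum>k\<in>UNIV. lam k *\<^sub>R (cnj (e k $ j) * x $ j * e k $ i))" for i
    by (simp add: matrix_vector_mult_def outer_def sum_distrib_right) (simp add: mult_ac)
  also have "\<dots> i = (\<Sum>k\<in>UNIV. lam k *\<^sub>R (cinner (e k) x *s e k)) $ i" for i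
    by (subst sum.swap) (simp add: cinner_def sum_distrib_right scaleR_sum_right)
  finally show ?thesis by (simp add: vec_eq_iff)
qed

lemma cinner_spectral_sum:
  fixes e :: "'n::finite \<Rightarrow> complex ^ 'n" and lam :: "'n \<Rightarrow> real"
  shows "Re (cinner x ((\<Sum>k\<in>UNIV. lam k *\<^sub>R outer (e k) (e k)) *v x))
    = (\<Sum>k\<in>UNIV. lam k * (cmod (cinner (e k) x))\<^sup>2)"
proof -
  have "cinner x ((\<Sum>k\<in>UNIV. lam k *\<^sub>R outer (e k) (e k)) *v x)
      = (\<Sum>k\<in>UNIV. of_real (lam k) * (cinner (e k) x * cnj (cinner (e k) x)))"
    by (simp add: spectral_sum_mult_vec cinner_sum_right cinner_scaleR_right cinner_scale_right cnj_cinner)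
  also have "\<dots> = of_real (\<Sum>k\<in>UNIV. lam k * (cmod (cinner (e k) x))\<^sup>2)"
    by (simp only: of_real_sum of_real_mult complex_norm_square)
  finally show ?thesis by simp
qed

text \<open>The spectral theorem makes the choice in \<open>vn_entropy\<close> well founded. The
  decomposition used from here on is one that realises the chosen value, so the entropy equals
  \<open>shannon lam\<close> by construction.\<close>

lemma density_matrix_spectrum:
  fixes \<rho> :: "complex ^ 'n ^ 'n"
  assumes rho: "density_matrix \<rho>"
  obtains e :: "'n \<Rightarrow> complex ^ 'n" and lam :: "'n \<Rightarrow> real"
  where "orthonormal_basis e" "\<And>k. 0 \<le> lam k" "(\<Sum>k\<in>UNIV. lam k) = 1"
    "\<And>x. Re (cinner x (\<rho> *v x)) = (\<Sum>k\<in>UNIV. lam k * (cmod (cinner (e k) x))\<^sup>2)"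
    "vn_entropy \<rho> = shannon lam"
proof -
  obtain e0 :: "'n \<Rightarrow> complex ^ 'n" and lam0 :: "'n \<Rightarrow> real" where
    "orthonormal_basis e0" "\<rho> = (\<Sum>k\<in>UNIV. lam0 k *\<^sub>R outer (e0 k) (e0 k))"
    using rho spectral_decomposition[of \<rho>] unfolding density_matrix_def by blast
  then have "\<exists>s (e :: 'n \<Rightarrow> complex ^ 'n) (lam :: 'n \<Rightarrow> real).
      orthonormal_basis e \<and> \<rho> = (\<Sum>k\<in>UNIV. lam k *\<^sub>R outer (e k) (e k)) \<and>
      s = - (\<Sum>k\<in>UNIV. lam k * ln (lam k))"
    by blast
  from someI_ex[OF this] obtain e :: "'n \<Rightarrow> complex ^ 'n" and lam :: "'n \<Rightarrow> real" where
    e: "orthonormal_basis e" and dec: "\<rho> = (\<Sum>k\<in>UNIV. lam k *\<^sub>R outer (e k) (e k))"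
    and S: "vn_entropy \<rho> = shannon lam"
    unfolding vn_entropy_def shannon_def by blast
  have form: "Re (cinner x (\<rho> *v x)) = (\<Sum>k\<in>UNIV. lam k * (cmod (cinner (e k) x))\<^sup>2)" for x
    unfolding dec by (rule cinner_spectral_sum)
  have "0 \<le> lam k" for k
  proof -
    have "Re (cinner (e k) (\<rho> *v e k)) = lam k"
      using e by (simp add: form orthonormal_basis_def if_distrib[of cmod]
          if_distrib[of "\<lambda>x. x\<^sup>2"] if_distrib[of "(*) _"] cong: if_cong)
    then show ?thesis using rho by (metis density_matrix_def)
  qed
  moreover have "(\<Sum>k\<in>UNIV. lam k) = 1"
  proof -
    have "1 = (\<Sum>i\<in>UNIV. \<Sum>k\<in>UNIV. lam k *\<^sub>R (cnj (e k $ i) * e k $ i))"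
      using rho by (simp add: density_matrix_def dec outer_def mult.commute)
    also have "\<dots> = (\<Sum>k\<in>UNIV. lam k *\<^sub>R cinner (e k) (e k))"
      by (subst sum.swap) (simp add: cinner_def scaleR_sum_right)
    also have "\<dots> = of_real (\<Sum>k\<in>UNIV. lam k)"
      using e by (simp add: orthonormal_basis_def scaleR_conv_of_real)
    finally show ?thesis by (metis of_real_eq_1_iff)
  qed
  ultimately show ?thesis using that e form S by blast
qed

section \<open>Majorization and decreasing rearrangements\<close>

lemma sum_list_take_eq_sum: "n \<le> length xs \<Longrightarrow> sum_list (take n xs) = (\<Sum>i<n. xs ! i)"
  by (simp add: sum_list_sum_nth atLeast0LessThan)

lemma dotl_eq_sum: "length x = length y \<Longrightarrow> dotl x y = (\<Sum>i<length y. x ! i * y ! i)"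
  by (simp add: dotl_def sum_list_sum_nth atLeast0LessThan)

text \<open>A threshold argument: with \<open>t\<close> the \<open>n\<close>-th entry of
  \<open>ys\<close>, always \<open>z \<le> t + max (z - t) 0\<close>. The total excess over
  \<open>t\<close> is invariant under permutation, and in \<open>ys\<close> it sits entirely in the
  first \<open>n\<close> entries, where the bound is an equality.\<close>

lemma sum_list_take_le_sorted:
  fixes ys zs :: "real list"
  assumes mset: "mset zs = mset ys" and sorted: "sorted_wrt (\<ge>) ys" and n: "n \<le> length ys"
  shows "sum_list (take n zs) \<le> sum_list (take n ys)"
proof (cases "n = 0")
  case False
  define t where "t = ys ! (n - 1)"
  define u where "u = (\<lambda>z. max (z - t) 0)"
  have len: "length zs = length ys" using mset by (rule mset_eq_length)
  have "sum_list (take n zs) \<le> sum_list (map (\<lambda>z. t + u z) (take n zs))"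
    unfolding u_def by (rule order_trans[OF _ sum_list_mono[of _ "\<lambda>z. z"]]) simp_all
  also have "\<dots> = n * t + sum_list (map u (take n zs))"
    using n len by (simp add: sum_list_addf sum_list_triv)
  also have "\<dots> \<le> n * t + (sum_list (map u (take n zs)) + sum_list (map u (drop n zs)))"
    by (auto simp: u_def intro!: sum_list_nonneg)
  also have "\<dots> = n * t + sum_list (map u zs)"
    by (metis append_take_drop_id map_append sum_list_append)
  also have "sum_list (map u zs) = sum_list (map u ys)"
    by (metis mset mset_map sum_mset_sum_list)
  also have "\<dots> = sum_list (map u (take n ys)) + sum_list (map u (drop n ys))"
    by (metis append_take_drop_id map_append sum_list_append)
  also have "map u (drop n ys) = map (\<lambda>_. 0) (drop n ys)"
  proof (rule map_cong[OF refl])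
    fix y assume "y \<in> set (drop n ys)"
    then obtain i where "y = ys ! (n + i)" "i < length ys - n"
      by (metis in_set_conv_nth length_drop n nth_drop)
    then have "y \<le> t"
      using sorted_wrt_nth_less[OF sorted, of "n - 1" "n + i"] False by (simp add: t_def)
    then show "u y = 0" by (simp add: u_def)
  qed
  also have "map u (take n ys) = map (\<lambda>y. y - t) (take n ys)"
  proof (rule map_cong[OF refl])
    fix y assume "y \<in> set (take n ys)"
    then obtain i where "y = ys ! i" "i < n" "i < length ys"
      by (auto simp: in_set_conv_nth)
    then have "y \<ge> t"
      using sorted_wrt_nth_less[OF sorted, of i "n - 1"] n False
      by (cases "i = n - 1") (auto simp: t_def)
    then show "u y = y - t" by (simp add: u_def)
  qed
  finally show ?thesis
    using n by (simp add: sum_list_subtractf sum_list_triv)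
qed simp

text \<open>Summation by parts as an induction: since the partial sums of \<open>d\<close> are
  nonnegative, lowering their weight from \<open>c (N - 1)\<close> to \<open>c N\<close> only
  decreases the left side.\<close>

lemma abel_summation_lower_bound:
  fixes d c :: "nat \<Rightarrow> real"
  assumes "\<And>n. n \<le> N \<Longrightarrow> 0 \<le> (\<Sum>i<n. d i)" and "\<And>i. Suc i < N \<Longrightarrow> c (Suc i) \<le> c i"
  shows "(\<Sum>i<N. d i) * c (N - 1) \<le> (\<Sum>i<N. d i * c i)"
  using assms
proof (induction N)
  case (Suc N)
  have "(\<Sum>i<N. d i) * c N \<le> (\<Sum>i<N. d i) * c (N - 1)"
  proof (cases N)
    case (Suc M)
    then show ?thesis using Suc.prems(1)[of N] Suc.prems(2)[of M] by (simp add: mult_left_mono)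
  qed simp
  also have "\<dots> \<le> (\<Sum>i<N. d i * c i)" using Suc by simp
  finally show ?case by (simp add: distrib_right)
qed simp

lemma mset_decr_list: "mset (decr_list f) = image_mset f (mset_set UNIV)"
  by (simp add: decr_list_def)

lemma length_decr_list: "length (decr_list (f :: 'a::finite \<Rightarrow> real)) = CARD('a)"
  by (metis mset_decr_list size_image_mset size_mset size_mset_set)

lemma sorted_decr_list: "sorted_wrt (\<ge>) (decr_list f)"
  by (simp add: decr_list_def sorted_wrt_rev)

lemma decr_eq_self:
  assumes "sorted_wrt (\<ge>) xs"
  shows "decr xs = xs"
proof -
  have "sort xs = rev xs"
    by (rule properties_for_sort) (use assms in \<open>simp_all add: sorted_wrt_rev\<close>)
  then show ?thesis by (simp add: decr_def)
qed

lemma decr_list_eqI: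
  assumes "sorted_wrt (\<ge>) xs" and "mset xs = image_mset f (mset_set UNIV)"
  shows "decr_list f = xs"
proof -
  have "sorted_list_of_multiset (image_mset f (mset_set UNIV)) = sort xs"
    by (metis assms(2) sorted_list_of_multiset_mset)
  then show ?thesis using decr_eq_self[OF assms(1)] by (simp add: decr_list_def decr_def)
qed

lemma decr_list_enumeration:
  fixes f :: "'a::finite \<Rightarrow> real"
  obtains xs where "distinct xs" "set xs = UNIV" "decr_list f = map f xs"
proof -
  obtain ys :: "'a list" where ys: "set ys = UNIV" "distinct ys"
    using finite_distinct_list[of "UNIV :: 'a set"] by auto
  define xs where "xs = sort_key (\<lambda>x. - f x) ys"
  have xs: "set xs = UNIV" "distinct xs" using ys by (simp_all add: xs_def)
  have "sorted (map (\<lambda>x. - f x) xs)" by (simp add: xs_def)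
  then have "sorted_wrt (\<ge>) (map f xs)" by (simp add: sorted_wrt_map)
  moreover have "mset (map f xs) = image_mset f (mset_set UNIV)"
    using xs by (metis mset_map mset_set_set)
  ultimately show ?thesis using that xs decr_list_eqI by blast
qed

lemma sum_eq_sum_enumeration:
  assumes "distinct xs" "set xs = (UNIV :: 'a::finite set)"
  shows "(\<Sum>x\<in>UNIV. F x) = (\<Sum>i<CARD('a). F (xs ! i))"
proof -
  have "length xs = CARD('a)" using assms by (metis distinct_card)
  then show ?thesis
    by (metis assms bij_betw_nth lessThan_atLeast0 sum.reindex_bij_betw)
qed

text \<open>Enumerate along decreasing \<open>G\<close>. Any \<open>n\<close> values of
  \<open>f\<close> sum to at most its \<open>n\<close> largest, hence to at most the first
  \<open>n\<close> entries of \<open>Q\<close>. So the differences \<open>d\<close> have nonnegative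
  partial sums, and their total is zero, which kills the boundary term.\<close>

lemma sum_mult_le_dotl_decr_list:
  fixes f G :: "'a::finite \<Rightarrow> real"
  assumes maj: "majorized (decr_list f) Q" and Q: "sorted_wrt (\<ge>) Q"
  shows "(\<Sum>x\<in>UNIV. f x * G x) \<le> dotl Q (decr_list G)"
proof -
  obtain xs where xs: "distinct xs" "set xs = UNIV" and G: "decr_list G = map G xs"
    by (rule decr_list_enumeration)
  let ?N = "CARD('a)"
  have len: "length xs = ?N" "length Q = ?N"
    using xs maj by (metis distinct_card, metis length_decr_list majorized_def)
  have msetf: "mset (map f xs) = mset (decr_list f)"
    using xs by (metis mset_map mset_set_set mset_decr_list)
  define d where "d = (\<lambda>i. Q ! i - f (xs ! i))"
  have sums: "(\<Sum>i<n. d i) = sum_list (take n Q) - sum_list (take n (map f xs))" if "n \<le> ?N" for n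
    using that len by (simp add: sum_list_take_eq_sum d_def sum_subtractf)
  have "0 \<le> (\<Sum>i<n. d i)" if n: "n \<le> ?N" for n
  proof -
    have "sum_list (take n (map f xs)) \<le> sum_list (take n (decr_list f))"
      using msetf sorted_decr_list n by (intro sum_list_take_le_sorted) (auto simp: length_decr_list)
    also have "\<dots> \<le> sum_list (take n Q)"
      using maj n Q by (auto simp: majorized_def decr_eq_self sorted_decr_list length_decr_list)
    finally show ?thesis using sums[OF n] by simp
  qed
  moreover have "G (xs ! Suc i) \<le> G (xs ! i)" if "Suc i < ?N" for i
    using sorted_wrt_nth_less[OF sorted_decr_list[of G], of i "Suc i"] that len G by simp
  ultimately have "(\<Sum>i<?N. d i) * G (xs ! (?N - 1)) \<le> (\<Sum>i<?N. d i * G (xs ! i))"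
    by (intro abel_summation_lower_bound) auto
  moreover have "(\<Sum>i<?N. d i) = 0"
  proof -
    have "sum_list (map f xs) = sum_list Q"
      using maj msetf by (metis majorized_def sum_mset_sum_list)
    then show ?thesis using sums[of ?N] len by simp
  qed
  ultimately show ?thesis
    using len by (simp add: d_def G dotl_eq_sum left_diff_distrib sum_subtractf
        sum_eq_sum_enumeration[OF xs])
qed

text \<open>The preceding bound for \<open>- G\<close>, since negation reverses the order.\<close>

lemma sum_mult_ge_dotl_incr_list:
  fixes f G :: "'a::finite \<Rightarrow> real"
  assumes maj: "majorized (decr_list f) Q" and Q: "sorted_wrt (\<ge>) Q"
  shows "dotl Q (incr_list G) \<le> (\<Sum>x\<in>UNIV. f x * G x)"
proof -
  have "decr_list (\<lambda>x. - G x) = map uminus (incr_list G)"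
  proof (rule decr_list_eqI)
    have "sorted (incr_list G)" by (simp add: incr_list_def)
    then show "sorted_wrt (\<ge>) (map uminus (incr_list G))" by (simp add: sorted_wrt_map)
    show "mset (map uminus (incr_list G)) = image_mset (\<lambda>x. - G x) (mset_set UNIV)"
      by (simp add: incr_list_def image_mset.compositionality comp_def)
  qed
  moreover have "dotl Q (map uminus ys) = - dotl Q ys" for ys
    by (simp add: dotl_def zip_map2 comp_def case_prod_unfold uminus_sum_list_map)
  ultimately show ?thesis
    using sum_mult_le_dotl_decr_list[OF maj Q, of "\<lambda>x. - G x"] by (simp add: sum_negf)
qed

text \<open>Keep the weight at an index of the largest value and bound all other values by the
  second largest. On a one-element type index 1 is out of range, but its coefficient
  \<open>1 - f x\<close> is then zero.\<close>

lemma sum_mult_le_two_largest: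
  fixes f G :: "'a::finite \<Rightarrow> real"
  assumes f: "\<And>x. 0 \<le> f x" "(\<Sum>x\<in>UNIV. f x) = 1"
  obtains x where "G x = decr_list G ! 0"
    "(\<Sum>x\<in>UNIV. f x * G x) \<le> decr_list G ! 0 * f x + decr_list G ! 1 * (1 - f x)"
    "decr_list G ! 1 \<le> decr_list G ! 0 \<or> CARD('a) = 1"
proof -
  obtain xs where xs: "distinct xs" "set xs = UNIV" and G: "decr_list G = map G xs"
    by (rule decr_list_enumeration)
  let ?N = "CARD('a)"
  have len: "length xs = ?N" using xs by (metis distinct_card)
  obtain M where M: "?N = Suc M" by (metis Suc_pred zero_less_card_finite)
  have G0: "decr_list G ! 0 = G (xs ! 0)" using G len M by simp
  have le: "G (xs ! j) \<le> decr_list G ! i" if "i \<le> j" "j < ?N" for i j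
    using sorted_wrt_nth_less[OF sorted_decr_list[of G], of i j] that len G
    by (cases "i = j") auto
  have "(\<Sum>x\<in>UNIV. f x * G x) = f (xs ! 0) * G (xs ! 0) + (\<Sum>i<M. f (xs ! Suc i) * G (xs ! Suc i))"
    by (simp add: sum_eq_sum_enumeration[OF xs] M sum.lessThan_Suc_shift del: sum.lessThan_Suc)
  also have "\<dots> \<le> f (xs ! 0) * G (xs ! 0) + (\<Sum>i<M. f (xs ! Suc i) * decr_list G ! 1)"
    by (intro add_left_mono sum_mono mult_left_mono f le) (auto simp: M)
  also have "\<dots> = f (xs ! 0) * G (xs ! 0) + (1 - f (xs ! 0)) * decr_list G ! 1"
    using f(2) by (simp add: sum_eq_sum_enumeration[OF xs] M sum.lessThan_Suc_shift
        del: sum.lessThan_Suc flip: sum_distrib_right)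
  finally have "(\<Sum>x\<in>UNIV. f x * G x) \<le> decr_list G ! 0 * f (xs ! 0) + decr_list G ! 1 * (1 - f (xs ! 0))"
    using G0 by (simp add: mult.commute)
  moreover have "decr_list G ! 1 \<le> decr_list G ! 0 \<or> ?N = 1"
  proof (cases "M = 0")
    case False
    then show ?thesis using le[of 0 1] len M G by simp
  qed (simp add: M)
  ultimately show ?thesis using that G0 by metis
qed

section \<open>Monotonicity of the relative entropy under a measurement\<close>

lemma has_derivative_sum_weighted_ln:
  fixes P Q :: "'a::finite \<Rightarrow> real"
  assumes P: "\<And>x. 0 \<le> P x" and Q: "\<And>x. P x \<noteq> 0 \<Longrightarrow> 0 < Q x" and s: "0 \<le> s"
  shows "((\<lambda>s. \<Sum>x\<in>UNIV. P x * (ln (Q x + s * P x) - ln (Q x)))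
    has_real_derivative (\<Sum>x\<in>UNIV. (P x)\<^sup>2 / (Q x + s * P x))) (at s)"
proof (rule DERIV_sum)
  fix x
  show "((\<lambda>s. P x * (ln (Q x + s * P x) - ln (Q x)))
    has_real_derivative (P x)\<^sup>2 / (Q x + s * P x)) (at s)"
  proof (cases "P x = 0")
    case False
    then have "0 < Q x + s * P x" using Q[of x] P[of x] s by (simp add: add_pos_nonneg)
    then show ?thesis
      by (auto intro!: derivative_eq_intros simp: power2_eq_square)
  qed simp
qed

text \<open>Removing the divergence works because
  \<open>ln (Q x + s * P x) - ln s = ln (Q x / s + P x)\<close> for large \<open>s\<close>, and this
  tends to \<open>ln (P x)\<close> when \<open>P x > 0\<close>.\<close>

lemma tendsto_sum_weighted_ln:
  fixes P Q :: "'a::finite \<Rightarrow> real"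
  assumes P: "\<And>x. 0 \<le> P x"
  shows "((\<lambda>s. (\<Sum>x\<in>UNIV. P x * (ln (Q x + s * P x) - ln (Q x))) - (\<Sum>x\<in>UNIV. P x) * ln s)
    \<longlongrightarrow> (\<Sum>x\<in>UNIV. P x * (ln (P x) - ln (Q x)))) at_top"
proof -
  have "((\<lambda>s. P x * (ln (Q x + s * P x) - ln (Q x)) - P x * ln s)
    \<longlongrightarrow> P x * (ln (P x) - ln (Q x))) at_top" for x
  proof (cases "P x = 0")
    case False
    then have pos: "0 < P x" using P[of x] by simp
    have Q0: "((\<lambda>s. Q x / s) \<longlongrightarrow> 0) at_top"
      by (intro tendsto_divide_0[OF tendsto_const] filterlim_at_top_imp_at_infinity filterlim_ident)
    have "((\<lambda>s. P x * (ln (Q x / s + P x) - ln (Q x))) \<longlongrightarrow> P x * (ln (0 + P x) - ln (Q x))) at_top"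
      using pos by (intro tendsto_mult tendsto_diff tendsto_ln tendsto_add Q0 tendsto_const) simp
    moreover have "eventually (\<lambda>s. 0 < Q x / s + P x) at_top"
      using order_tendstoD(1)[OF tendsto_add[OF Q0 tendsto_const[of "P x"]]] pos by simp
    then have "eventually (\<lambda>s. P x * (ln (Q x / s + P x) - ln (Q x))
        = P x * (ln (Q x + s * P x) - ln (Q x)) - P x * ln s) at_top"
      using eventually_gt_at_top[of 0]
    proof eventually_elim
      case (elim s)
      then have "ln (s * (Q x / s + P x)) = ln s + ln (Q x / s + P x)" by (simp add: ln_mult_pos)
      moreover have "s * (Q x / s + P x) = Q x + s * P x" using elim by (simp add: field_simps)
      ultimately have "ln (Q x + s * P x) = ln s + ln (Q x / s + P x)" by simp
      then show ?case by (simp add: algebra_simps)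
    qed
    ultimately show ?thesis using Lim_transform_eventually by fastforce
  qed simp
  then show ?thesis
    by (simp add: sum_distrib_right tendsto_sum flip: sum_subtractf)
qed

text \<open>Since \<open>d/ds P ln (Q + s P) = P\<^sup>2 / (Q + s P)\<close>, integrating the hypothesis over
  \<open>0 \<le> s \<le> \<infinity>\<close> yields the relative entropies.\<close>

lemma relative_entropy_le_if_resolvent_le:
  fixes P Q :: "'a::finite \<Rightarrow> real" and u v :: "'b::finite \<Rightarrow> real"
  assumes P: "\<And>x. 0 \<le> P x" "\<And>x. P x \<noteq> 0 \<Longrightarrow> 0 < Q x"
    and u: "\<And>y. 0 \<le> u y" "\<And>y. u y \<noteq> 0 \<Longrightarrow> 0 < v y"
    and sum_eq: "(\<Sum>x\<in>UNIV. P x) = (\<Sum>y\<in>UNIV. u y)"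
    and le: "\<And>s. 0 \<le> s \<Longrightarrow>
      (\<Sum>y\<in>UNIV. (u y)\<^sup>2 / (v y + s * u y)) \<le> (\<Sum>x\<in>UNIV. (P x)\<^sup>2 / (Q x + s * P x))"
  shows "(\<Sum>y\<in>UNIV. u y * (ln (u y) - ln (v y))) \<le> (\<Sum>x\<in>UNIV. P x * (ln (P x) - ln (Q x)))"
proof -
  define f where "f = (\<lambda>s. \<Sum>x\<in>UNIV. P x * (ln (Q x + s * P x) - ln (Q x)))"
  define g where "g = (\<lambda>s. \<Sum>y\<in>UNIV. u y * (ln (v y + s * u y) - ln (v y)))"
  have mono: "g s \<le> f s" if "0 \<le> s" for s
  proof -
    \<comment> \<open>Both functions vanish at 0, and the hypothesis compares their
      derivatives.\<close>
    have "f 0 - g 0 \<le> f s - g s"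
    proof (rule DERIV_nonneg_imp_nondecreasing[OF that])
      fix t :: real assume "0 \<le> t"
      then have "((\<lambda>s. f s - g s) has_real_derivative
          (\<Sum>x\<in>UNIV. (P x)\<^sup>2 / (Q x + t * P x)) - (\<Sum>y\<in>UNIV. (u y)\<^sup>2 / (v y + t * u y))) (at t)"
        unfolding f_def g_def
        by (intro DERIV_diff has_derivative_sum_weighted_ln P u)
      then show "\<exists>y. ((\<lambda>s. f s - g s) has_real_derivative y) (at t) \<and> 0 \<le> y"
        using le[OF \<open>0 \<le> t\<close>] by (meson diff_ge_0_iff_ge)
    qed
    then show ?thesis by (simp add: f_def g_def)
  qed
  \<comment> \<open>By \<open>sum_eq\<close> the divergent terms of \<open>f\<close> and
    \<open>g\<close> coincide, so \<open>g s \<le> f s\<close> survives their removal and the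
    limit.\<close>
  have f_lim: "((\<lambda>s. f s - (\<Sum>y\<in>UNIV. u y) * ln s)
      \<longlongrightarrow> (\<Sum>x\<in>UNIV. P x * (ln (P x) - ln (Q x)))) at_top"
    unfolding f_def sum_eq[symmetric] by (rule tendsto_sum_weighted_ln[OF P(1)])
  have g_lim: "((\<lambda>s. g s - (\<Sum>y\<in>UNIV. u y) * ln s)
      \<longlongrightarrow> (\<Sum>y\<in>UNIV. u y * (ln (u y) - ln (v y)))) at_top"
    unfolding g_def by (rule tendsto_sum_weighted_ln[OF u(1)])
  have "eventually (\<lambda>s. g s - (\<Sum>y\<in>UNIV. u y) * ln s \<le> f s - (\<Sum>y\<in>UNIV. u y) * ln s) at_top"
    using eventually_ge_at_top[of 0] by eventually_elim (use mono in simp)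
  then show ?thesis
    by (rule tendsto_le[OF trivial_limit_at_top_linorder f_lim g_lim])
qed

section \<open>The resolvent inequality for a measurement and the resulting entropy bound\<close>

lemma sum_UNIV_pair:
  "(\<Sum>x\<in>UNIV. f x) = (\<Sum>i\<in>UNIV. \<Sum>j\<in>UNIV. f (i :: 'a::finite, j :: 'b::finite))"
  by (simp add: sum.cartesian_product flip: UNIV_Times_UNIV)

text \<open>With \<open>t = p + s * l\<close>, this is
  \<open>(l * cmod A - t * cmod Z)\<^sup>2 / t \<ge> 0\<close> after cancelling
  \<open>(cmod A)\<^sup>2\<close> on the right. If \<open>l = 0\<close> or \<open>A = 0\<close>, the
  right side is 0 and the left side is at most 0.\<close>

lemma two_Re_minus_le_divide:
  fixes A Z :: complex and l p s :: real
  assumes "0 \<le> l" "0 \<le> p" "0 \<le> s" and pos: "l * (cmod A)\<^sup>2 \<noteq> 0 \<Longrightarrow> 0 < p"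
  shows "2 * l * Re (cnj A * Z) - (cmod Z)\<^sup>2 * (p + s * l)
    \<le> (l * (cmod A)\<^sup>2)\<^sup>2 / (p * (cmod A)\<^sup>2 + s * (l * (cmod A)\<^sup>2))"
proof (cases "l = 0 \<or> A = 0")
  case True
  then show ?thesis using assms by auto
next
  case False
  define t where "t = p + s * l"
  have "0 < t" using False assms pos by (simp add: t_def add_pos_nonneg)
  have "0 \<le> (l * cmod A - t * cmod Z)\<^sup>2 / t" using \<open>0 < t\<close> by simp
  also have "\<dots> = l\<^sup>2 * (cmod A)\<^sup>2 / t - 2 * l * (cmod A * cmod Z) + (cmod Z)\<^sup>2 * t"
    using \<open>0 < t\<close> by (simp add: field_simps power2_eq_square)
  finally have "2 * l * (cmod A * cmod Z) - (cmod Z)\<^sup>2 * t \<le> l\<^sup>2 * (cmod A)\<^sup>2 / t" by simp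
  moreover have "l * Re (cnj A * Z) \<le> l * (cmod A * cmod Z)"
    using complex_Re_le_cmod[of "cnj A * Z"] assms(1)
    by (intro mult_left_mono) (simp_all add: norm_mult)
  moreover have "(l * (cmod A)\<^sup>2)\<^sup>2 / (p * (cmod A)\<^sup>2 + s * (l * (cmod A)\<^sup>2)) = l\<^sup>2 * (cmod A)\<^sup>2 / t"
  proof -
    have "(l * (cmod A)\<^sup>2)\<^sup>2 = (cmod A)\<^sup>2 * (l\<^sup>2 * (cmod A)\<^sup>2)"
      "p * (cmod A)\<^sup>2 + s * (l * (cmod A)\<^sup>2) = (cmod A)\<^sup>2 * t"
      by (simp_all add: t_def algebra_simps power2_eq_square)
    then show ?thesis using False by (simp only: mult_divide_mult_cancel_left power_eq_0_iff norm_eq_zero) simp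
  qed
  ultimately show ?thesis by (simp add: t_def mult.assoc)
qed

lemma norm_squared_sum_orthonormal:
  assumes "orthonormal_basis b"
  shows "(norm (\<Sum>j\<in>UNIV. z j *s b j))\<^sup>2 = (\<Sum>j\<in>UNIV. (cmod (z j))\<^sup>2)"
proof -
  have "cinner (\<Sum>j\<in>UNIV. z j *s b j) (b m) = cnj (z m)" for m
    using assms
    by (simp add: cinner_sum_left cinner_scale_left orthonormal_basis_def if_distrib[of "(*) _"]
        cong: if_cong)
  then show ?thesis
    by (simp flip: sum_cmod_cinner_squared[OF assms])
qed

text \<open>With \<open>\<Delta>\<close> the relative modular operator of \<open>\<sigma> = \<Sum>\<^sub>i p\<^sub>i |a\<^sub>i\<rangle>\<langle>a\<^sub>i|\<close> and \<open>\<rho>\<close>, and \<open>\<psi> = \<rho>\<^sup>1\<^sup>/\<^sup>2\<close>,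
  this is the variational bound
  \<open>\<langle>\<psi>, (\<Delta> + s)\<^sup>-\<^sup>1 \<psi>\<rangle> \<ge> 2 Re \<langle>\<psi>, \<phi>\<rangle> - \<langle>\<phi>, (\<Delta> + s) \<phi>\<rangle>\<close> for \<open>\<phi> = \<rho>\<^sup>1\<^sup>/\<^sup>2 Y\<close>,
  \<open>Y = \<Sum>\<^sub>j y\<^sub>j |b\<^sub>j\<rangle>\<langle>b\<^sub>j|\<close>, written out in the bases \<open>e\<close> and \<open>a\<close>. In the proof \<open>Z k i = \<langle>e\<^sub>k|Y|a\<^sub>i\<rangle>\<close>,
  and \<open>y\<close> is the optimal choice.\<close>

lemma resolvent_measurement_le:
  fixes a b e :: "'n::finite \<Rightarrow> complex ^ 'n" and lam p q r :: "'n \<Rightarrow> real"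
  assumes e: "orthonormal_basis e" and a: "orthonormal_basis a" and b: "orthonormal_basis b"
    and lam: "\<And>k. 0 \<le> lam k" and p: "\<And>i. 0 \<le> p i"
    and supp: "\<And>k i. lam k * (cmod (cinner (e k) (a i)))\<^sup>2 \<noteq> 0 \<Longrightarrow> 0 < p i"
    and q: "\<And>j. q j = (\<Sum>k\<in>UNIV. lam k * (cmod (cinner (e k) (b j)))\<^sup>2)"
    and r: "\<And>j. r j = (\<Sum>i\<in>UNIV. p i * (cmod (cinner (a i) (b j)))\<^sup>2)"
    and s: "0 \<le> s"
  shows "(\<Sum>j\<in>UNIV. (q j)\<^sup>2 / (r j + s * q j)) \<le> (\<Sum>k\<in>UNIV. \<Sum>i\<in>UNIV.
    (lam k * (cmod (cinner (e k) (a i)))\<^sup>2)\<^sup>2 /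
    (p i * (cmod (cinner (e k) (a i)))\<^sup>2 + s * (lam k * (cmod (cinner (e k) (a i)))\<^sup>2)))"
proof -
  define y where "y = (\<lambda>j. q j / (r j + s * q j))"
  define Z where "Z = (\<lambda>k i. \<Sum>j\<in>UNIV. of_real (y j) * cinner (e k) (b j) * cinner (b j) (a i))"
  \<comment> \<open>Here \<open>v\<close> is \<open>Y\<close> applied to \<open>e k\<close>, and in
    \<open>Zcol\<close> it is \<open>Y\<close> applied to \<open>a i\<close>; Parseval gives both
    sums.\<close>
  have Zrow: "(\<Sum>i\<in>UNIV. (cmod (Z k i))\<^sup>2) = (\<Sum>j\<in>UNIV. (y j)\<^sup>2 * (cmod (cinner (e k) (b j)))\<^sup>2)" for k
  proof -
    define v where "v = (\<Sum>j\<in>UNIV. (of_real (y j) * cinner (b j) (e k)) *s b j)"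
    have "Z k i = cinner v (a i)" for i
      by (simp add: Z_def v_def cinner_sum_left cinner_scale_left cnj_cinner)
    then have "(\<Sum>i\<in>UNIV. (cmod (Z k i))\<^sup>2) = (norm v)\<^sup>2"
      by (simp add: sum_cmod_cinner_squared[OF a])
    also have "\<dots> = (\<Sum>j\<in>UNIV. (y j)\<^sup>2 * (cmod (cinner (e k) (b j)))\<^sup>2)"
      by (simp add: v_def norm_squared_sum_orthonormal[OF b] norm_mult power_mult_distrib
          cmod_cinner_commute[of "e k"])
    finally show ?thesis .
  qed
  have Zcol: "(\<Sum>k\<in>UNIV. (cmod (Z k i))\<^sup>2) = (\<Sum>j\<in>UNIV. (y j)\<^sup>2 * (cmod (cinner (a i) (b j)))\<^sup>2)" for i
  proof -
    define v where "v = (\<Sum>j\<in>UNIV. (of_real (y j) * cinner (b j) (a i)) *s b j)"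
    have "Z k i = cinner (e k) v" for k
      by (simp add: Z_def v_def cinner_sum_right cinner_scale_right mult_ac)
    then have "(\<Sum>k\<in>UNIV. (cmod (Z k i))\<^sup>2) = (norm v)\<^sup>2"
      by (simp add: cmod_cinner_commute[of _ v] sum_cmod_cinner_squared[OF e])
    also have "\<dots> = (\<Sum>j\<in>UNIV. (y j)\<^sup>2 * (cmod (cinner (a i) (b j)))\<^sup>2)"
      by (simp add: v_def norm_squared_sum_orthonormal[OF b] norm_mult power_mult_distrib
          cmod_cinner_commute[of "a i"])
    finally show ?thesis .
  qed
  \<comment> \<open>Summing out the basis \<open>a\<close> leaves the diagonal entry of
    \<open>Y\<close> at \<open>e k\<close>.\<close>
  have Zdiag: "(\<Sum>i\<in>UNIV. cnj (cinner (e k) (a i)) * Z k i)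
      = of_real (\<Sum>j\<in>UNIV. y j * (cmod (cinner (e k) (b j)))\<^sup>2)" for k
  proof -
    have "(\<Sum>i\<in>UNIV. cnj (cinner (e k) (a i)) * Z k i)
      = (\<Sum>i\<in>UNIV. \<Sum>j\<in>UNIV. of_real (y j) * cinner (e k) (b j) * (cinner (b j) (a i) * cinner (a i) (e k)))"
      by (simp add: Z_def cnj_cinner sum_distrib_left mult_ac)
    also have "\<dots> = (\<Sum>j\<in>UNIV. of_real (y j) * cinner (e k) (b j) * cinner (b j) (e k))"
      by (subst sum.swap) (simp add: cinner_parseval[OF a, of "b _" "e k"] flip: sum_distrib_left)
    also have "\<dots> = of_real (\<Sum>j\<in>UNIV. y j * (cmod (cinner (e k) (b j)))\<^sup>2)"
      by (simp only: of_real_sum of_real_mult complex_norm_square cnj_cinner mult.assoc)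
    finally show ?thesis .
  qed
  have sum1: "(\<Sum>k\<in>UNIV. \<Sum>i\<in>UNIV. 2 * lam k * Re (cnj (cinner (e k) (a i)) * Z k i))
      = (\<Sum>j\<in>UNIV. 2 * (y j * q j))"
  proof -
    have "(\<Sum>i\<in>UNIV. 2 * lam k * Re (cnj (cinner (e k) (a i)) * Z k i))
        = 2 * lam k * (\<Sum>j\<in>UNIV. y j * (cmod (cinner (e k) (b j)))\<^sup>2)" for k
      using arg_cong[OF Zdiag[of k], of Re]
      by (simp only: Re_sum Re_complex_of_real flip: sum_distrib_left)
    then have "(\<Sum>k\<in>UNIV. \<Sum>i\<in>UNIV. 2 * lam k * Re (cnj (cinner (e k) (a i)) * Z k i))
        = (\<Sum>k\<in>UNIV. \<Sum>j\<in>UNIV. 2 * (y j * (lam k * (cmod (cinner (e k) (b j)))\<^sup>2)))"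
      by (simp only: sum_distrib_left mult_ac)
    also have "\<dots> = (\<Sum>j\<in>UNIV. 2 * (y j * q j))"
      by (subst sum.swap) (simp add: q sum_distrib_left)
    finally show ?thesis .
  qed
  have sum2: "(\<Sum>k\<in>UNIV. \<Sum>i\<in>UNIV. (cmod (Z k i))\<^sup>2 * p i) = (\<Sum>j\<in>UNIV. (y j)\<^sup>2 * r j)"
  proof -
    have "(\<Sum>k\<in>UNIV. \<Sum>i\<in>UNIV. (cmod (Z k i))\<^sup>2 * p i)
        = (\<Sum>i\<in>UNIV. \<Sum>j\<in>UNIV. (y j)\<^sup>2 * (p i * (cmod (cinner (a i) (b j)))\<^sup>2))"
      by (subst sum.swap, unfold sum_distrib_right[symmetric] Zcol)
         (simp only: sum_distrib_left mult_ac)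
    also have "\<dots> = (\<Sum>j\<in>UNIV. (y j)\<^sup>2 * r j)"
      by (subst sum.swap) (simp add: r sum_distrib_left)
    finally show ?thesis .
  qed
  have sum3: "(\<Sum>k\<in>UNIV. \<Sum>i\<in>UNIV. (cmod (Z k i))\<^sup>2 * (s * lam k)) = (\<Sum>j\<in>UNIV. (y j)\<^sup>2 * (s * q j))"
  proof -
    have "(\<Sum>k\<in>UNIV. \<Sum>i\<in>UNIV. (cmod (Z k i))\<^sup>2 * (s * lam k))
        = (\<Sum>k\<in>UNIV. \<Sum>j\<in>UNIV. (y j)\<^sup>2 * (s * (lam k * (cmod (cinner (e k) (b j)))\<^sup>2)))"
      by (unfold sum_distrib_right[symmetric] Zrow)
         (simp only: sum_distrib_left mult_ac)
    also have "\<dots> = (\<Sum>j\<in>UNIV. (y j)\<^sup>2 * (s * q j))"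
      by (subst sum.swap) (simp add: q sum_distrib_left)
    finally show ?thesis .
  qed
  \<comment> \<open>The value of the quadratic in \<open>y j\<close> at its maximiser. For a zero
    denominator, division by zero makes \<open>y j\<close> and both sides 0.\<close>
  have "(q j)\<^sup>2 / (r j + s * q j) = 2 * (y j * q j) - (y j)\<^sup>2 * r j - (y j)\<^sup>2 * (s * q j)" for j
  proof (cases "r j + s * q j = 0")
    case False
    then have yq: "y j * (r j + s * q j) = q j" by (simp add: y_def)
    have "2 * (y j * q j) - (y j)\<^sup>2 * r j - (y j)\<^sup>2 * (s * q j)
        = 2 * (y j * q j) - y j * (y j * (r j + s * q j))"
      by (simp add: algebra_simps power2_eq_square)
    also have "\<dots> = y j * q j" by (simp add: yq)
    also have "\<dots> = (q j)\<^sup>2 / (r j + s * q j)" by (simp add: y_def power2_eq_square)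
    finally show ?thesis ..
  qed (simp add: y_def)
  then have "(\<Sum>j\<in>UNIV. (q j)\<^sup>2 / (r j + s * q j))
      = (\<Sum>j\<in>UNIV. 2 * (y j * q j)) - (\<Sum>j\<in>UNIV. (y j)\<^sup>2 * r j) - (\<Sum>j\<in>UNIV. (y j)\<^sup>2 * (s * q j))"
    by (simp only: sum_subtractf)
  also have "\<dots> = (\<Sum>k\<in>UNIV. \<Sum>i\<in>UNIV. 2 * lam k * Re (cnj (cinner (e k) (a i)) * Z k i)
      - (cmod (Z k i))\<^sup>2 * (p i + s * lam k))"
    by (simp only: sum1[symmetric] sum2[symmetric] sum3[symmetric] distrib_left sum_subtractf sum.distrib diff_diff_eq)
  also have "\<dots> \<le> (\<Sum>k\<in>UNIV. \<Sum>i\<in>UNIV.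
    (lam k * (cmod (cinner (e k) (a i)))\<^sup>2)\<^sup>2 /
    (p i * (cmod (cinner (e k) (a i)))\<^sup>2 + s * (lam k * (cmod (cinner (e k) (a i)))\<^sup>2)))"
    by (intro sum_mono two_Re_minus_le_divide lam p s supp)
  finally show ?thesis .
qed

text \<open>The relative entropy of \<open>P\<close> with respect to \<open>Q\<close>, both on pairs
  \<open>(k, i)\<close>, equals \<open>shannon p - shannon lam\<close>, and that of \<open>q\<close>
  with respect to \<open>r\<close> is
  \<open>- shannon q - (\<Sum>j\<in>UNIV. q j * ln (r j))\<close>.\<close>

lemma measured_entropy_bound:
  fixes a b e :: "'n::finite \<Rightarrow> complex ^ 'n" and lam p q r :: "'n \<Rightarrow> real"
  assumes e: "orthonormal_basis e" and a: "orthonormal_basis a" and b: "orthonormal_basis b"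
    and lam: "\<And>k. 0 \<le> lam k"
    and p: "\<And>i. p i = (\<Sum>k\<in>UNIV. lam k * (cmod (cinner (e k) (a i)))\<^sup>2)"
    and q: "\<And>j. q j = (\<Sum>k\<in>UNIV. lam k * (cmod (cinner (e k) (b j)))\<^sup>2)"
    and r: "\<And>j. r j = (\<Sum>i\<in>UNIV. p i * (cmod (cinner (a i) (b j)))\<^sup>2)"
  shows "shannon p + shannon q \<ge> - (\<Sum>j\<in>UNIV. q j * ln (r j)) + shannon lam"
    and "\<And>j. q j \<noteq> 0 \<Longrightarrow> 0 < r j"
proof -
  define w where "w = (\<lambda>k i. (cmod (cinner (e k) (a i)))\<^sup>2)"
  have w0: "0 \<le> w k i" for k i by (simp add: w_def)
  have w1: "(\<Sum>i\<in>UNIV. w k i) = 1" for k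
    by (simp add: w_def sum_cmod_cinner_squared[OF a] norm_orthonormal_basis[OF e])
  have p0: "0 \<le> p i" for i by (simp add: p lam sum_nonneg)
  have q0: "0 \<le> q i" for i by (simp add: q lam sum_nonneg)
  have r0: "0 \<le> r j" for j by (simp add: r p0 sum_nonneg)
  have supp: "0 < p i" if "lam k * w k i \<noteq> 0" for k i
  proof -
    have "0 < lam k * w k i" using that lam[of k] w0[of k i] by (simp add: order_less_le)
    also have "\<dots> \<le> p i" unfolding p w_def
      by (rule member_le_sum) (auto simp: lam)
    finally show ?thesis .
  qed
  \<comment> \<open>If \<open>r j = 0\<close>, then \<open>b j\<close> is orthogonal to every
    \<open>a i\<close> with \<open>p i > 0\<close>. Each \<open>e k\<close> with
    \<open>lam k > 0\<close> is a combination of those \<open>a i\<close>, so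
    \<open>q j = 0\<close>.\<close>
  show supp_r: "0 < r j" if "q j \<noteq> 0" for j
  proof (rule ccontr)
    assume "\<not> 0 < r j"
    then have "r j = 0" using r0[of j] by simp
    then have pU: "p i = 0 \<or> cinner (a i) (b j) = 0" for i
      by (simp add: r sum_nonneg_eq_0_iff p0)
    have "lam k * (cmod (cinner (e k) (b j)))\<^sup>2 = 0" for k
    proof (cases "lam k = 0")
      case False
      have "cinner (e k) (a i) * cinner (a i) (b j) = 0" for i
        using pU[of i] supp[of k i] False by (cases "cinner (e k) (a i) = 0") (auto simp: w_def)
      then have "cinner (e k) (b j) = 0"
        unfolding cinner_parseval[OF a, of "e k" "b j"] by (intro sum.neutral) blast
      then show ?thesis by simp
    qed simp
    then have "q j = 0" unfolding q by (intro sum.neutral) blast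
    then show False using that by blast
  qed
  \<comment> \<open>The common factor \<open>w k i\<close> cancels in the logarithm of the ratio,
    leaving \<open>ln (lam k) - ln (p i)\<close>.\<close>
  define P where "P = (\<lambda>(k, i). lam k * w k i)"
  define Q where "Q = (\<lambda>(k, i). p i * w k i)"
  have sum_lam: "(\<Sum>x\<in>UNIV. P x) = (\<Sum>k\<in>UNIV. lam k)"
    by (simp add: sum_UNIV_pair P_def w1 flip: sum_distrib_left)
  have sum_q: "(\<Sum>j\<in>UNIV. q j) = (\<Sum>k\<in>UNIV. lam k)"
    unfolding q
    by (subst sum.swap)
       (simp add: sum_cmod_cinner_squared[OF b] norm_orthonormal_basis[OF e] flip: sum_distrib_left)
  have "(\<Sum>j\<in>UNIV. q j * (ln (q j) - ln (r j))) \<le> (\<Sum>x\<in>UNIV. P x * (ln (P x) - ln (Q x)))"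
  proof (rule relative_entropy_le_if_resolvent_le)
    show "0 \<le> P x" for x by (simp add: P_def lam w0 split: prod.split)
    show "0 < Q x" if "P x \<noteq> 0" for x
      using that supp w0 by (auto simp: P_def Q_def order_less_le split: prod.splits)
    show "(\<Sum>x\<in>UNIV. P x) = (\<Sum>j\<in>UNIV. q j)" by (simp add: sum_lam sum_q)
    show "(\<Sum>j\<in>UNIV. (q j)\<^sup>2 / (r j + s * q j)) \<le> (\<Sum>x\<in>UNIV. (P x)\<^sup>2 / (Q x + s * P x))"
      if "0 \<le> s" for s
      using resolvent_measurement_le[OF e a b lam p0 supp[unfolded w_def] q r that]
      by (simp add: sum_UNIV_pair P_def Q_def w_def)
  qed (use q0 supp_r in auto)
  also have "(\<Sum>x\<in>UNIV. P x * (ln (P x) - ln (Q x)))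
      = (\<Sum>k\<in>UNIV. \<Sum>i\<in>UNIV. lam k * ln (lam k) * w k i - lam k * w k i * ln (p i))"
    unfolding sum_UNIV_pair
  proof (intro sum.cong refl)
    fix k i
    show "P (k, i) * (ln (P (k, i)) - ln (Q (k, i))) = lam k * ln (lam k) * w k i - lam k * w k i * ln (p i)"
    proof (cases "lam k * w k i = 0")
      case True
      then show ?thesis by (auto simp: P_def)
    next
      case False
      then have "0 < lam k" "0 < w k i" "0 < p i"
        using lam[of k] w0[of k i] supp[of k i] by (auto simp: order_less_le)
      then show ?thesis by (simp add: P_def Q_def ln_mult_pos algebra_simps)
    qed
  qed
  also have "\<dots> = (\<Sum>k\<in>UNIV. \<Sum>i\<in>UNIV. lam k * ln (lam k) * w k i)
      - (\<Sum>i\<in>UNIV. \<Sum>k\<in>UNIV. lam k * w k i * ln (p i))"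
    by (simp add: sum_subtractf) (rule sum.swap)
  also have "\<dots> = (\<Sum>k\<in>UNIV. lam k * ln (lam k)) - (\<Sum>i\<in>UNIV. p i * ln (p i))"
    by (simp add: w1 flip: sum_distrib_left sum_distrib_right) (simp add: w_def flip: p)
  finally show "shannon p + shannon q \<ge> - (\<Sum>j\<in>UNIV. q j * ln (r j)) + shannon lam"
    by (simp add: shannon_def right_diff_distrib sum_subtractf)
qed

text \<open>The tangent to \<open>ln\<close> at the mean \<open>m\<close> gives
  \<open>ln (r j) \<le> ln m + r j / m - 1\<close>, which is averaged with weights
  \<open>q\<close>.\<close>

lemma jensen_ln:
  fixes q r :: "'a::finite \<Rightarrow> real"
  assumes q: "\<And>j. 0 \<le> q j" "(\<Sum>j\<in>UNIV. q j) = 1" and r: "\<And>j. 0 \<le> r j" "\<And>j. q j \<noteq> 0 \<Longrightarrow> 0 < r j"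
  shows "0 < (\<Sum>j\<in>UNIV. q j * r j)"
    and "(\<Sum>j\<in>UNIV. q j * ln (r j)) \<le> ln (\<Sum>j\<in>UNIV. q j * r j)"
proof -
  define m where "m = (\<Sum>j\<in>UNIV. q j * r j)"
  obtain j0 where "q j0 \<noteq> 0" using q(2) by (metis sum.neutral zero_neq_one)
  then have "0 < q j0 * r j0" using q(1)[of j0] r(2)[of j0] by (simp add: order_less_le)
  also have "\<dots> \<le> m" unfolding m_def by (rule member_le_sum) (auto simp: q r)
  finally show m: "0 < (\<Sum>j\<in>UNIV. q j * r j)" by (simp add: m_def)
  have "(\<Sum>j\<in>UNIV. q j * ln (r j)) \<le> (\<Sum>j\<in>UNIV. q j * (ln m - 1) + q j * r j / m)"
  proof (rule sum_mono)
    fix j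
    show "q j * ln (r j) \<le> q j * (ln m - 1) + q j * r j / m"
    proof (cases "q j = 0")
      case False
      then have "0 < r j / m" using r(2)[of j] m by (simp add: m_def)
      then have "ln (r j / m) \<le> r j / m - 1" by (rule ln_le_minus_one)
      then have "ln (r j) \<le> ln m - 1 + r j / m"
        using r(2)[OF False] m by (simp add: ln_div m_def)
      then have "q j * ln (r j) \<le> q j * (ln m - 1 + r j / m)" using q(1) by (rule mult_left_mono)
      then show ?thesis by (simp add: distrib_left)
    qed simp
  qed
  also have "\<dots> = (\<Sum>j\<in>UNIV. q j) * (ln m - 1) + m / m"
    by (simp add: sum.distrib flip: sum_distrib_right sum_divide_distrib m_def)
  also have "\<dots> = ln m" using m q(2) by (simp add: m_def)
  finally show "(\<Sum>j\<in>UNIV. q j * ln (r j)) \<le> ln (\<Sum>j\<in>UNIV. q j * r j)" by (simp add: m_def)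
qed

section \<open>The uncertainty relations\<close>

text \<open>Let \<open>s\<close> be the left side and \<open>v\<close> the sum of the components of
  \<open>\<psi>\<close> along \<open>x\<close> and \<open>y\<close>. Then
  \<open>v \<bullet> \<psi> = s\<close>, and Cauchy-Schwarz gives
  \<open>s\<^sup>2 \<le> (norm v)\<^sup>2\<close>. The cross term of \<open>(norm v)\<^sup>2\<close>
  is at most \<open>s * cmod (cinner x y)\<close>, by
  \<open>2 * cmod \<alpha> * cmod \<beta> \<le> s\<close>.\<close>

lemma landau_pollak:
  fixes x y \<psi> :: "complex ^ 'n"
  assumes "norm x = 1" "norm y = 1" "norm \<psi> = 1"
  shows "(cmod (cinner \<psi> x))\<^sup>2 + (cmod (cinner \<psi> y))\<^sup>2 \<le> 1 + cmod (cinner x y)"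
proof -
  define \<alpha> \<beta> where "\<alpha> = cinner x \<psi>" and "\<beta> = cinner y \<psi>"
  define s where "s = (cmod \<alpha>)\<^sup>2 + (cmod \<beta>)\<^sup>2"
  define v where "v = \<alpha> *s x + \<beta> *s y"
  have "cinner v \<psi> = \<alpha> * cnj \<alpha> + \<beta> * cnj \<beta>"
    by (simp add: v_def cinner_add_left cinner_scale_left \<alpha>_def \<beta>_def mult.commute)
  then have "v \<bullet> \<psi> = s"
    by (simp add: inner_eq_Re_cinner s_def flip: complex_norm_square)
  then have "s \<le> norm v" using Cauchy_Schwarz_ineq2[of v \<psi>] assms by simp
  moreover have "0 \<le> s" by (simp add: s_def)
  ultimately have "s\<^sup>2 \<le> (norm v)\<^sup>2" by (rule power_mono)
  also have "(norm v)\<^sup>2 = Re (cinner v v)" by (simp add: cinner_self)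
  also have "cinner v v = \<alpha> * cnj \<alpha> + \<beta> * cnj \<beta> + (cnj \<alpha> * \<beta> * cinner x y + cnj (cnj \<alpha> * \<beta> * cinner x y))"
    using assms by (simp add: v_def cinner_add_left cinner_add_right cinner_scale_left
        cinner_scale_right cinner_self[of x] cinner_self[of y] cnj_cinner algebra_simps)
  also have "Re \<dots> = s + 2 * Re (cnj \<alpha> * \<beta> * cinner x y)"
    by (simp only: s_def plus_complex.sel Re_complex_of_real cnj.sel flip: complex_norm_square)
  also have "\<dots> \<le> s + 2 * (cmod \<alpha> * cmod \<beta> * cmod (cinner x y))"
    using complex_Re_le_cmod[of "cnj \<alpha> * \<beta> * cinner x y"] by (simp add: norm_mult)
  also have "\<dots> \<le> s + s * cmod (cinner x y)"
    using sum_squares_bound[of "cmod \<alpha>" "cmod \<beta>"]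
    by (simp add: s_def mult_right_mono flip: mult.assoc)
  finally have "s * s \<le> s * (1 + cmod (cinner x y))" by (simp add: power2_eq_square algebra_simps)
  then have "s \<le> 1 + cmod (cinner x y)"
  proof (cases "s = 0")
    case False
    then show ?thesis using \<open>s * s \<le> s * _\<close> \<open>0 \<le> s\<close> by simp
  qed simp
  then show ?thesis by (simp add: s_def \<alpha>_def \<beta>_def cmod_cinner_commute[of _ \<psi>])
qed

lemma mult_le_half_sum_squared:
  fixes x y t :: real
  assumes "0 \<le> x" "0 \<le> y" "x + y \<le> 2 * t"
  shows "x * y \<le> t\<^sup>2"
proof -
  have "(x + y)\<^sup>2 \<le> (2 * t)\<^sup>2" using assms by (intro power_mono) auto
  moreover have "4 * (x * y) \<le> (x + y)\<^sup>2"
    using zero_le_power2[of "x - y"] by (simp add: power2_eq_square algebra_simps)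
  ultimately show ?thesis by (simp add: power2_eq_square)
qed

theorem theorem1:
  fixes \<rho> :: "complex ^ 'n ^ 'n"
    and a b :: "'n \<Rightarrow> complex ^ 'n"
  assumes rho: "density_matrix \<rho>"
    and a: "orthonormal_basis a"
    and b: "orthonormal_basis b"
  defines "U \<equiv> (\<lambda>i j. cinner (a i) (b j))"
    and "p \<equiv> (\<lambda>i. Re (cinner (a i) (\<rho> *v a i)))"
    and "q \<equiv> (\<lambda>j. Re (cinner (b j) (\<rho> *v b j)))"
    and "c \<equiv> decr_list (\<lambda>(i, j). (cmod (cinner (a i) (b j)))\<^sup>2)"
  shows
    "(\<forall>Q :: real list.
        length Q = CARD('n) ^ 2 \<and> (\<forall>x\<in>set Q. 0 \<le> x) \<and> sum_list Q = 1 \<and>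
        sorted_wrt (\<ge>) Q \<and> majorized (decr_list (\<lambda>(i, j). p i * q j)) Q \<longrightarrow>
        shannon p + shannon q \<ge> - ln (dotl Q c) + vn_entropy \<rho>)
   \<and> shannon p + shannon q \<ge> - ln (c ! 0 * ((1 + sqrt (c ! 0)) / 2)\<^sup>2 + c ! 1 * (1 - ((1 + sqrt (c ! 0)) / 2)\<^sup>2)) + vn_entropy \<rho>
   \<and> (\<forall>Q :: real list.
        length Q = CARD('n) ^ 2 \<and> (\<forall>x\<in>set Q. 0 \<le> x) \<and> sum_list Q = 1 \<and>
        sorted_wrt (\<ge>) Q \<and> majorized (decr_list (\<lambda>(i, j). p i * q j)) Q \<longrightarrow>
        (let h = (\<lambda>(k, l). decr_list (\<lambda>(i, j). (cmod (U k j))\<^sup>2 * (cmod (U i l))\<^sup>2));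
             g = incr_list (\<lambda>kl. - ln (dotl Q (h kl)))
         in shannon p + shannon q \<ge> (1/2) * dotl Q g + vn_entropy \<rho>))"
proof -
  obtain e :: "'n \<Rightarrow> complex ^ 'n" and lam :: "'n \<Rightarrow> real" where
    e: "orthonormal_basis e" and lam: "\<And>k. 0 \<le> lam k" "(\<Sum>k\<in>UNIV. lam k) = 1"
    and form: "\<And>x. Re (cinner x (\<rho> *v x)) = (\<Sum>k\<in>UNIV. lam k * (cmod (cinner (e k) x))\<^sup>2)"
    and S: "vn_entropy \<rho> = shannon lam"
    using density_matrix_spectrum[OF rho] by blast
  have p: "p i = (\<Sum>k\<in>UNIV. lam k * (cmod (cinner (e k) (a i)))\<^sup>2)" for i
    by (simp add: p_def form)
  have q: "q j = (\<Sum>k\<in>UNIV. lam k * (cmod (cinner (e k) (b j)))\<^sup>2)" for j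
    by (simp add: q_def form)
  have p0: "0 \<le> p i" and q0: "0 \<le> q i" for i by (simp_all add: p q lam sum_nonneg)
  have p1: "(\<Sum>i\<in>UNIV. p i) = 1" and q1: "(\<Sum>j\<in>UNIV. q j) = 1"
    unfolding p q
    by (subst sum.swap, simp add: sum_cmod_cinner_squared[OF a] sum_cmod_cinner_squared[OF b]
        norm_orthonormal_basis[OF e] lam flip: sum_distrib_left)+
  define r where "r = (\<lambda>j. \<Sum>i\<in>UNIV. p i * (cmod (U i j))\<^sup>2)"
  define r' where "r' = (\<lambda>i. \<Sum>j\<in>UNIV. q j * (cmod (U i j))\<^sup>2)"
  have r0: "0 \<le> r j" for j by (simp add: r_def p0 sum_nonneg)
  have bound: "shannon p + shannon q \<ge> - (\<Sum>j\<in>UNIV. q j * ln (r j)) + vn_entropy \<rho>"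
    and rpos: "\<And>j. q j \<noteq> 0 \<Longrightarrow> 0 < r j"
    unfolding S using measured_entropy_bound[OF e a b lam(1) p q, of r]
    by (simp_all add: r_def U_def)
  \<comment> \<open>The same bound with the two bases exchanged.\<close>
  have bound': "shannon p + shannon q \<ge> - (\<Sum>i\<in>UNIV. p i * ln (r' i)) + vn_entropy \<rho>"
    and r'pos: "\<And>i. p i \<noteq> 0 \<Longrightarrow> 0 < r' i"
    unfolding S using measured_entropy_bound[OF e b a lam(1) q p, of r']
    by (simp_all add: r'_def U_def cmod_cinner_commute[of "a _"] add.commute)
  define f where "f = (\<lambda>(i, j). p i * q j)"
  define G where "G = (\<lambda>(i, j). (cmod (cinner (a i) (b j)))\<^sup>2)"
  define T where "T = (\<Sum>x\<in>UNIV. f x * G x)"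
  have f0: "0 \<le> f x" for x by (simp add: f_def p0 q0 split: prod.split)
  have f1: "(\<Sum>x\<in>UNIV. f x) = 1"
    by (simp add: sum_UNIV_pair f_def p1 q1 flip: sum_distrib_left)
  have T_eq: "T = (\<Sum>j\<in>UNIV. q j * r j)"
    unfolding T_def sum_UNIV_pair
    by (subst sum.swap) (simp add: f_def G_def r_def U_def sum_distrib_left mult_ac)
  have T_pos: "0 < T" and T_bound: "shannon p + shannon q \<ge> - ln T + vn_entropy \<rho>"
    using jensen_ln[of q r, OF q0 q1 r0 rpos] bound by (auto simp: T_eq)
  have c: "c = decr_list G" by (simp add: c_def G_def)
  \<comment> \<open>Parts (i) and (ii) thus reduce to upper bounds on \<open>T\<close>.\<close>
  have key: "shannon p + shannon q \<ge> - ln t + vn_entropy \<rho>" if "T \<le> t" for t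
  proof -
    have "ln T \<le> ln t" using T_pos that by simp
    then show ?thesis using T_bound by simp
  qed
  have part1: "shannon p + shannon q \<ge> - ln (dotl Q c) + vn_entropy \<rho>"
    if "sorted_wrt (\<ge>) Q" "majorized (decr_list f) Q" for Q
    unfolding c by (rule key) (simp add: T_def sum_mult_le_dotl_decr_list that)
  define C where "C = (1 + sqrt (c ! 0)) / 2"
  have part2: "shannon p + shannon q \<ge> - ln (c ! 0 * C\<^sup>2 + c ! 1 * (1 - C\<^sup>2)) + vn_entropy \<rho>"
  proof (rule key)
    obtain x where x: "G x = c ! 0" "T \<le> c ! 0 * f x + c ! 1 * (1 - f x)"
      "c ! 1 \<le> c ! 0 \<or> CARD('n \<times> 'n) = 1"
      using sum_mult_le_two_largest[of f G] f0 f1 unfolding c T_def by metis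
    obtain i j where ij: "x = (i, j)" by (cases x)
    have sqrt_c: "sqrt (c ! 0) = cmod (cinner (a i) (b j))"
      by (simp flip: x(1) add: ij G_def)
    \<comment> \<open>The Landau-Pollak inequality for each pure state \<open>e k\<close> is
      averaged over the spectrum.\<close>
    have "p i + q j = (\<Sum>k\<in>UNIV. lam k * ((cmod (cinner (e k) (a i)))\<^sup>2 + (cmod (cinner (e k) (b j)))\<^sup>2))"
      by (simp add: p q distrib_left sum.distrib)
    also have "\<dots> \<le> (\<Sum>k\<in>UNIV. lam k * (1 + cmod (cinner (a i) (b j))))"
      by (intro sum_mono mult_left_mono landau_pollak lam norm_orthonormal_basis a b e)
    also have "\<dots> = 2 * C"
      by (simp add: C_def sqrt_c lam flip: sum_distrib_right)
    finally have fC: "f x \<le> C\<^sup>2"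
      unfolding ij f_def by (simp add: mult_le_half_sum_squared p0 q0)
    from x(3) show "T \<le> c ! 0 * C\<^sup>2 + c ! 1 * (1 - C\<^sup>2)"
    proof
      \<comment> \<open>The two-value bound is nondecreasing in the weight \<open>f x\<close>, so
        \<open>f x\<close> may be raised to \<open>C\<^sup>2\<close>.\<close>
      assume le: "c ! 1 \<le> c ! 0"
      have "c ! 0 * f x + c ! 1 * (1 - f x) = c ! 1 + (c ! 0 - c ! 1) * f x"
        by (simp add: algebra_simps)
      also have "\<dots> \<le> c ! 1 + (c ! 0 - c ! 1) * C\<^sup>2"
        using le fC by (intro add_left_mono mult_left_mono) auto
      finally show ?thesis using x(2) by (simp add: algebra_simps)
    next
      \<comment> \<open>In dimension one the list \<open>c\<close> has no entry at index 1, but then \<open>C = 1\<close>.\<close>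
      assume "CARD('n \<times> 'n) = 1"
      then have "CARD('n) = 1" by simp
      then have UNIV: "UNIV = {k}" for k :: 'n
        by (metis UNIV_I card_1_singletonE singletonD)
      have "(cmod (cinner (a i) (b j)))\<^sup>2 = (norm (a i))\<^sup>2"
        using sum_cmod_cinner_squared[OF b, of "a i"] unfolding UNIV[of j] by simp
      then have "c ! 0 = 1"
        by (simp flip: x(1) add: ij G_def norm_orthonormal_basis[OF a])
      moreover have "f x = 1"
        using f1 unfolding ij sum_UNIV_pair by (subst (asm) UNIV[of i], subst (asm) UNIV[of j]) simp
      ultimately show ?thesis using x(2) by (simp add: C_def)
    qed
  qed
  define h where "h = (\<lambda>(k, l). decr_list (\<lambda>(i, j). (cmod (U k j))\<^sup>2 * (cmod (U i l))\<^sup>2))"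
  have part3: "shannon p + shannon q \<ge> (1/2) * dotl Q (incr_list (\<lambda>kl. - ln (dotl Q (h kl)))) + vn_entropy \<rho>"
    if Q: "sorted_wrt (\<ge>) Q" "majorized (decr_list f) Q" for Q
  proof -
    \<comment> \<open>First use of majorization, outside the logarithm.\<close>
    have "dotl Q (incr_list (\<lambda>kl. - ln (dotl Q (h kl)))) \<le> (\<Sum>x\<in>UNIV. f x * - ln (dotl Q (h x)))"
      by (rule sum_mult_ge_dotl_incr_list[OF Q(2,1)])
    also have "\<dots> \<le> (\<Sum>k\<in>UNIV. \<Sum>l\<in>UNIV. - (p k * (q l * ln (r l)) + q l * (p k * ln (r' k))))"
      unfolding sum_UNIV_pair
    proof (intro sum_mono)
      fix k l
      show "f (k, l) * - ln (dotl Q (h (k, l))) \<le> - (p k * (q l * ln (r l)) + q l * (p k * ln (r' k)))"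
      \<comment> \<open>Zero weights make both sides 0; otherwise the arguments of the logarithms
        are positive.\<close>
      proof (cases "p k = 0 \<or> q l = 0")
        case True
        then show ?thesis by (auto simp: f_def)
      next
        case False
        then have pos: "0 < r l" "0 < r' k" using rpos r'pos by auto
        \<comment> \<open>The product is an average over \<open>p \<otimes> q\<close> of the entries
          of \<open>h (k, l)\<close>, so majorization applies again, inside the logarithm.\<close>
        have "r l * r' k = (\<Sum>x\<in>UNIV. f x * (\<lambda>(i, j). (cmod (U k j))\<^sup>2 * (cmod (U i l))\<^sup>2) x)"
          by (simp add: sum_UNIV_pair r_def r'_def f_def sum_product mult_ac)
        also have "\<dots> \<le> dotl Q (h (k, l))"
          unfolding h_def prod.case by (rule sum_mult_le_dotl_decr_list[OF Q(2,1)])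
        finally have "ln (r l * r' k) \<le> ln (dotl Q (h (k, l)))"
          by (rule ln_mono) (use pos in simp)
        then have "ln (r l) + ln (r' k) \<le> ln (dotl Q (h (k, l)))"
          using pos by (simp add: ln_mult_pos)
        then have "f (k, l) * (ln (r l) + ln (r' k)) \<le> f (k, l) * ln (dotl Q (h (k, l)))"
          using f0 by (rule mult_left_mono)
        then show ?thesis by (simp add: f_def algebra_simps)
      qed
    qed
    also have "\<dots> = - (\<Sum>j\<in>UNIV. q j * ln (r j)) - (\<Sum>i\<in>UNIV. p i * ln (r' i))"
      by (simp add: sum_negf sum_subtractf p1 q1 flip: sum_distrib_left sum_distrib_right)
    \<comment> \<open>The factor 1/2 comes from averaging the two bounds.\<close>
    finally show ?thesis using bound bound' by simp
  qed
  show ?thesis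
    using part1 part2 part3 unfolding f_def h_def C_def Let_def by blast
qed

end
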